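(* (i) Let $\mathcal{H}$ be a separable right (resp. left) quaternion Hilbert space and let $A_k \in \mathcal{B}(\mathcal{H})$ ($k \in \mathbb{N}$) be non-realscalar bounded linear operators. Then there exists an orthonormal basis $\mathcal{E}$ for $\mathcal{H}$ such that $\langle A_k e, e' \rangle \neq 0$ for all $e, e' \in \mathcal{E}$ and all $k \in \mathbb{N}$. (ii) Let $n \in \mathbb{N}$ and let $A_k \in \mathbb{M}_n(\mathbb{H})$ ($k \in \mathbb{N}$) be non-realscalar matrices. Then there exists a unitary matrix $P \in \mathbb{M}_n(\mathbb{H})$ such that, for every $k \in \mathbb{N}$, the entries of $P^* A_k P$ are all nonzero.
   Context: $\mathbb{H}$ denotes the division ring of real quaternions. $\mathcal{B}(\mathcal{H})$ denotes the set of bounded (right, resp. left) $\mathbb{H}$-linear operators on the right (resp. left) quaternion Hilbert space $\mathcal{H}$, and $\langle\cdot,\cdot\rangle$ is its quaternion-valued inner product. An operator (resp. matrix) is non-realscalar if it is not of the form $rI$ with $r \in \mathbb{R}$. $P^*$ is the quaternionic conjugate transpose of $P$, and $P$ is unitary if $P^*P = PP^* = I$. *)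

theory Defs
  imports "HOL-Analysis.Analysis"
begin

section \<open>The division ring of real quaternions\<close>

datatype quat = Quat (re: real) (im_i: real) (im_j: real) (im_k: real)

lemma quat_eq_iff:
  "p = q \<longleftrightarrow> re p = re q \<and> im_i p = im_i q \<and> im_j p = im_j q \<and> im_k p = im_k q"
  by (cases p; cases q) simp

definition qconj :: "quat \<Rightarrow> quat"
  where "qconj q = Quat (re q) (- im_i q) (- im_j q) (- im_k q)"

lemma qconj_sel [simp]:
  "re (qconj q) = re q" "im_i (qconj q) = - im_i q"
  "im_j (qconj q) = - im_j q" "im_k (qconj q) = - im_k q"
  by (simp_all add: qconj_def)

instantiation quat :: ab_group_add
begin

definition "0 = Quat 0 0 0 0"
definition "p + q = Quat (re p + re q) (im_i p + im_i q) (im_j p + im_j q) (im_k p + im_k q)"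
definition "p - q = Quat (re p - re q) (im_i p - im_i q) (im_j p - im_j q) (im_k p - im_k q)"
definition "- q = Quat (- re q) (- im_i q) (- im_j q) (- im_k q)"

instance
  by standard (simp_all add: quat_eq_iff zero_quat_def plus_quat_def minus_quat_def uminus_quat_def)

end

lemma quat_add_sel [simp]:
  "re 0 = 0" "im_i 0 = 0" "im_j 0 = 0" "im_k 0 = 0"
  "re (p + q) = re p + re q" "im_i (p + q) = im_i p + im_i q"
  "im_j (p + q) = im_j p + im_j q" "im_k (p + q) = im_k p + im_k q"
  "re (p - q) = re p - re q" "im_i (p - q) = im_i p - im_i q"
  "im_j (p - q) = im_j p - im_j q" "im_k (p - q) = im_k p - im_k q"
  "re (- q) = - re q" "im_i (- q) = - im_i q" "im_j (- q) = - im_j q" "im_k (- q) = - im_k q"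
  by (simp_all add: zero_quat_def plus_quat_def minus_quat_def uminus_quat_def)

instantiation quat :: real_algebra_1
begin

definition "1 = Quat 1 0 0 0"

definition "p * q = Quat
  (re p * re q - im_i p * im_i q - im_j p * im_j q - im_k p * im_k q)
  (re p * im_i q + im_i p * re q + im_j p * im_k q - im_k p * im_j q)
  (re p * im_j q - im_i p * im_k q + im_j p * re q + im_k p * im_i q)
  (re p * im_k q + im_i p * im_j q - im_j p * im_i q + im_k p * re q)"

definition "scaleR r q = Quat (r * re q) (r * im_i q) (r * im_j q) (r * im_k q)"

instance
  by standard
    (simp_all add: quat_eq_iff one_quat_def times_quat_def scaleR_quat_def algebra_simps)

end

lemma quat_mult_sel [simp]:
  "re 1 = 1" "im_i 1 = 0" "im_j 1 = 0" "im_k 1 = 0"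
  "re (p * q) = re p * re q - im_i p * im_i q - im_j p * im_j q - im_k p * im_k q"
  "im_i (p * q) = re p * im_i q + im_i p * re q + im_j p * im_k q - im_k p * im_j q"
  "im_j (p * q) = re p * im_j q - im_i p * im_k q + im_j p * re q + im_k p * im_i q"
  "im_k (p * q) = re p * im_k q + im_i p * im_j q - im_j p * im_i q + im_k p * re q"
  "re (r *\<^sub>R q) = r * re q" "im_i (r *\<^sub>R q) = r * im_i q"
  "im_j (r *\<^sub>R q) = r * im_j q" "im_k (r *\<^sub>R q) = r * im_k q"
  by (simp_all add: one_quat_def times_quat_def scaleR_quat_def)

lemma of_real_quat_sel [simp]:
  "re (of_real r) = r" "im_i (of_real r) = 0" "im_j (of_real r) = 0" "im_k (of_real r) = 0"
  by (simp_all add: of_real_def)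

definition qnorm2 :: "quat \<Rightarrow> real"
  where "qnorm2 q = (re q)\<^sup>2 + (im_i q)\<^sup>2 + (im_j q)\<^sup>2 + (im_k q)\<^sup>2"

lemma qnorm2_eq_0_iff: "qnorm2 q = 0 \<longleftrightarrow> q = 0"
  by (simp add: qnorm2_def quat_eq_iff add_nonneg_eq_0_iff)

lemma mult_qconj: "q * qconj q = of_real (qnorm2 q)"
  by (simp add: quat_eq_iff qnorm2_def power2_eq_square)

lemma qconj_mult_self: "qconj q * q = of_real (qnorm2 q)"
  by (simp add: quat_eq_iff qnorm2_def power2_eq_square)

lemma qconj_mult: "qconj (p * q) = qconj q * qconj p"
  by (simp add: quat_eq_iff)

instantiation quat :: real_div_algebra
begin

definition "inverse q = (1 / qnorm2 q) *\<^sub>R qconj q"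
definition "p div q = p * inverse (q :: quat)"

instance
proof
  show "inverse q * q = 1" if "q \<noteq> 0" for q :: quat
    using that qnorm2_eq_0_iff[of q]
    by (simp add: inverse_quat_def qconj_mult_self of_real_def)
  show "q * inverse q = 1" if "q \<noteq> 0" for q :: quat
    using that qnorm2_eq_0_iff[of q]
    by (simp add: inverse_quat_def mult_qconj of_real_def)
  show "p div q = p * inverse q" for p q :: quat
    by (simp add: divide_quat_def)
  show "inverse (0 :: quat) = 0"
    by (simp add: quat_eq_iff inverse_quat_def)
qed

end


section \<open>Quaternion Hilbert spaces\<close>

text \<open>
  The underlying real Banach space is the type \<open>'a\<close>. For both sides the action of a quaternion is
  written \<open>act q x\<close>: it stands for \<open>x q\<close> in a right space and for \<open>q x\<close> in a left space, the
  two being told apart by the law \<open>act_act\<close>. The inner product is linear in its first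
  argument, so that the model cases are \<open>\<langle>x, y\<rangle> = \<Sum>i. qconj (y i) * x i\<close> on the right and
  \<open>\<langle>x, y\<rangle> = \<Sum>i. x i * qconj (y i)\<close> on the left. The opposite convention amounts to swapping the
  arguments, i.e. to conjugating the value.
\<close>

locale quat_hilbert =
  fixes act :: "quat \<Rightarrow> 'a::banach \<Rightarrow> 'a"
    and ip :: "'a \<Rightarrow> 'a \<Rightarrow> quat"
  assumes act_add_vec: "act q (x + y) = act q x + act q y"
    and act_add_quat: "act (p + q) x = act p x + act q x"
    and act_of_real: "act (of_real r) x = r *\<^sub>R x"
    and ip_add: "ip (x + y) z = ip x z + ip y z"
    and ip_conj: "ip y x = qconj (ip x y)"
    and ip_self: "ip x x = of_real ((norm x)\<^sup>2)"

locale right_quat_hilbert = quat_hilbert +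
  assumes act_act: "act p (act q x) = act (q * p) x"
    and ip_act: "ip (act q x) y = ip x y * q"

locale left_quat_hilbert = quat_hilbert +
  assumes act_act: "act p (act q x) = act (p * q) x"
    and ip_act: "ip (act q x) y = q * ip x y"

definition bounded_quat_linear ::
    "(quat \<Rightarrow> 'a \<Rightarrow> 'a) \<Rightarrow> ('a::real_normed_vector \<Rightarrow> 'a) \<Rightarrow> bool"
  where "bounded_quat_linear act T \<longleftrightarrow>
    bounded_linear T \<and> (\<forall>q x. T (act q x) = act q (T x))"

definition realscalar_op :: "('a::real_vector \<Rightarrow> 'a) \<Rightarrow> bool"
  where "realscalar_op T \<longleftrightarrow> (\<exists>r::real. T = (\<lambda>x. r *\<^sub>R x))"

definition quat_span :: "(quat \<Rightarrow> 'a \<Rightarrow> 'a) \<Rightarrow> 'a::real_vector set \<Rightarrow> 'a set"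
  where "quat_span act S = {\<Sum>x\<in>F. act (c x) x | F c. finite F \<and> F \<subseteq> S}"

definition orthonormal_basis ::
    "(quat \<Rightarrow> 'a \<Rightarrow> 'a) \<Rightarrow> ('a \<Rightarrow> 'a \<Rightarrow> quat) \<Rightarrow> 'a::real_normed_vector set \<Rightarrow> bool"
  where "orthonormal_basis act ip E \<longleftrightarrow>
    (\<forall>e\<in>E. \<forall>e'\<in>E. ip e e' = (if e = e' then 1 else 0)) \<and> closure (quat_span act E) = UNIV"


section \<open>Quaternion matrices\<close>

definition realscalar_matrix :: "quat^'n^'n \<Rightarrow> bool"
  where "realscalar_matrix M \<longleftrightarrow> (\<exists>r::real. M = mat (of_real r))"

definition conj_transpose :: "quat^'n^'m \<Rightarrow> quat^'m^'n"
  where "conj_transpose M = (\<chi> i j. qconj (M $ j $ i))"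

definition unitary_matrix :: "quat^'n^'n \<Rightarrow> bool"
  where "unitary_matrix P \<longleftrightarrow>
    conj_transpose P ** P = mat 1 \<and> P ** conj_transpose P = mat 1"

end

theory Submission
  imports Defs
begin

text \<open>
  Conjugating the action and the inner product turns a left space into a right one, and part (ii) is
  part (i) for the space of column vectors.

  In a right space take the Gram--Schmidt vectors \<open>w\<^sub>0, w\<^sub>1, \<dots>\<close> of a sequence of vectors, scaled
  so that they are polynomial in the sequence. Along a line of sequences \<open>\<langle>A\<^sub>k w\<^sub>i, w\<^sub>j\<rangle>\<close> is a
  polynomial in one real variable, so if it is nonzero for one sequence, it is nonzero on a
  dense open set of sequences. By Baire's theorem some sequence with dense range avoids all these zero
  sets at once, and its normalised Gram--Schmidt vectors form the basis.

  It remains to make each \<open>\<langle>A\<^sub>k w\<^sub>i, w\<^sub>j\<rangle>\<close> nonzero separately, i.e. to find one orthonormal system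
  with \<open>\<langle>A\<^sub>k e\<^sub>i, e\<^sub>j\<rangle> \<noteq> 0\<close>. If \<open>\<langle>A x, x\<rangle> = 0\<close> for all \<open>x\<close>, polarisation gives \<open>A = 0\<close>. If
  \<open>\<langle>A x, y\<rangle> = 0\<close> for all orthogonal \<open>x\<close>, \<open>y\<close>, then \<open>\<langle>A x, x\<rangle>\<close> takes the same value at any two
  orthogonal unit vectors; replacing one of them, \<open>y\<close>, by \<open>y q\<close> with \<open>|q| = 1\<close> shows that
  this value commutes with all quaternions, hence is real, and \<open>A\<close> is a real scalar.
\<close>

section \<open>Quaternions as a Euclidean space\<close>

instantiation quat :: real_normed_div_algebra
begin

definition "norm q = sqrt (qnorm2 q)"
definition "sgn q = q /\<^sub>R norm (q :: quat)"
definition "dist p q = norm (p - q :: quat)"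
definition [code del]:
  "(uniformity :: (quat \<times> quat) filter) = (INF e\<in>{0 <..}. principal {(p, q). dist p q < e})"
definition [code del]:
  "open (U :: quat set) \<longleftrightarrow> (\<forall>p\<in>U. eventually (\<lambda>(p', q). p' = p \<longrightarrow> q \<in> U) uniformity)"

instance
proof
  fix r :: real and p q :: quat
  show "norm p = 0 \<longleftrightarrow> p = 0"
    by (simp add: norm_quat_def qnorm2_eq_0_iff)
  \<comment> \<open>The triangle inequality is inherited from nested products of the real
    line.\<close>
  have norm_L2: "norm x = norm ((re x, im_i x), (im_j x, im_k x))" for x
    by (simp add: norm_quat_def qnorm2_def norm_Pair add.assoc)
  show "norm (p + q) \<le> norm p + norm q"
    using norm_triangle_ineq[of "((re p, im_i p), (im_j p, im_k p))" "((re q, im_i q), (im_j q, im_k q))"]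
    by (simp add: norm_L2)
  show "norm (r *\<^sub>R p) = \<bar>r\<bar> * norm p"
  proof -
    have "qnorm2 (r *\<^sub>R p) = r\<^sup>2 * qnorm2 p"
      by (simp add: qnorm2_def power2_eq_square algebra_simps)
    then show ?thesis
      by (simp add: norm_quat_def real_sqrt_mult)
  qed
  \<comment> \<open>Euler's four-square identity.\<close>
  have "qnorm2 (p * q) = qnorm2 p * qnorm2 q"
    by (simp add: qnorm2_def power2_eq_square algebra_simps)
  then show "norm (p * q) = norm p * norm q"
    by (simp add: norm_quat_def real_sqrt_mult)
qed (rule sgn_quat_def dist_quat_def open_quat_def uniformity_quat_def)+

end

lemma qnorm2_eq_norm: "qnorm2 q = (norm q)\<^sup>2"
  by (simp add: norm_quat_def qnorm2_def)

instantiation quat :: real_inner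
begin

definition inner_quat_def:
  "inner p q = re p * re q + im_i p * im_i q + im_j p * im_j q + im_k p * im_k q"

instance
proof
  fix p q s :: quat and r :: real
  show "inner p q = inner q p"
    "inner (p + q) s = inner p s + inner q s"
    "inner (scaleR r p) q = r * inner p q"
    by (simp_all add: inner_quat_def algebra_simps)
  have inner_self: "inner p p = qnorm2 p"
    by (simp add: inner_quat_def qnorm2_def power2_eq_square)
  then show "0 \<le> inner p p"
    by (simp add: qnorm2_eq_norm)
  show "inner p p = 0 \<longleftrightarrow> p = 0"
    using inner_self qnorm2_eq_0_iff by simp
  show "norm p = sqrt (inner p p)"
    using inner_self by (simp add: norm_quat_def)
qed

end

text \<open>With this instance \<open>quat^'n\<close> is a Banach space with a countable base and
  all its linear maps are bounded, which the matrix case requires.\<close>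

instantiation quat :: euclidean_space
begin

definition Basis_quat_def: "Basis = {Quat 1 0 0 0, Quat 0 1 0 0, Quat 0 0 1 0, Quat 0 0 0 1}"

instance
proof
  show "(Basis :: quat set) \<noteq> {}" "finite (Basis :: quat set)"
    by (simp_all add: Basis_quat_def)
  show "inner u v = (if u = v then 1 else 0)" if "u \<in> Basis" "v \<in> Basis" for u v :: quat
    using that unfolding Basis_quat_def by (elim insertE emptyE) (simp_all add: inner_quat_def)
  show "(\<forall>u\<in>Basis. inner x u = 0) \<longleftrightarrow> x = 0" for x :: quat
    by (simp add: Basis_quat_def inner_quat_def quat_eq_iff[of x])
qed

end

lemma qconj_simps [simp]:
  "qconj (qconj q) = q" "qconj 0 = 0" "qconj 1 = 1" "qconj (of_real r) = of_real r"
  "qconj (p + q) = qconj p + qconj q" "qconj (p - q) = qconj p - qconj q" "qconj (- p) = - qconj p"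
  by (simp_all add: quat_eq_iff)

lemma qconj_scaleR [simp]: "qconj (r *\<^sub>R q) = r *\<^sub>R qconj q"
  by (simp add: quat_eq_iff)

lemma qconj_eq_0_iff [simp]: "qconj q = 0 \<longleftrightarrow> q = 0"
  by (simp add: quat_eq_iff)

lemma qconj_sum: "qconj (sum f S) = (\<Sum>x\<in>S. qconj (f x))"
  by (induction S rule: infinite_finite_induct) simp_all

lemma norm_qconj [simp]: "norm (qconj q) = norm q"
  by (simp add: norm_quat_def qnorm2_def)

lemma of_real_mult_commute_quat: "of_real r * q = q * (of_real r :: quat)"
  by (simp add: quat_eq_iff)

section \<open>Right quaternion Hilbert spaces\<close>

context right_quat_hilbert
begin

lemma act_0_quat [simp]: "act 0 x = 0"
  using act_of_real[of 0 x] by simp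

lemma act_1 [simp]: "act 1 x = x"
  using act_of_real[of 1 x] by simp

lemma act_0_vec [simp]: "act q 0 = 0"
  using act_add_vec[of q 0 0] by simp

lemma act_scaleR_vec: "act q (r *\<^sub>R x) = r *\<^sub>R act q x"
  unfolding act_of_real[symmetric] act_act of_real_mult_commute_quat[of r q] ..

lemma act_scaleR_quat: "act (r *\<^sub>R q) x = r *\<^sub>R act q x"
  unfolding act_of_real[symmetric] act_act of_real_mult_commute_quat[of r q, symmetric]
    scaleR_conv_of_real[of r q] ..

lemma linear_act_vec: "linear (act q)"
  by (rule linearI) (simp_all add: act_add_vec act_scaleR_vec)

lemma linear_act_quat: "linear (\<lambda>q. act q x)"
  by (rule linearI) (simp_all add: act_add_quat act_scaleR_quat)

lemma ip_scaleR: "ip (r *\<^sub>R x) y = r *\<^sub>R ip x y"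
  unfolding act_of_real[symmetric] ip_act scaleR_conv_of_real of_real_mult_commute_quat[of r] ..

lemma linear_ip_left: "linear (\<lambda>x. ip x y)"
  by (rule linearI) (simp_all add: ip_add ip_scaleR)

lemma ip_add_right: "ip x (y + z) = ip x y + ip x z"
  by (subst (1 2 3) ip_conj) (simp add: ip_add)

lemma ip_scaleR_right: "ip x (r *\<^sub>R y) = r *\<^sub>R ip x y"
  by (subst (1 2) ip_conj) (simp add: ip_scaleR)

lemma ip_act_right: "ip x (act q y) = qconj q * ip x y"
  by (subst (1 2) ip_conj) (simp add: ip_act qconj_mult)

lemma linear_ip_right: "linear (ip x)"
  by (rule linearI) (simp_all add: ip_add_right ip_scaleR_right)

lemmas ip_linear_simps =
  linear_add[OF linear_ip_left] linear_diff[OF linear_ip_left] linear_0[OF linear_ip_left]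
  linear_sum[OF linear_ip_left] linear_neg[OF linear_ip_left] ip_scaleR ip_act
  linear_add[OF linear_ip_right] linear_diff[OF linear_ip_right] linear_0[OF linear_ip_right]
  linear_sum[OF linear_ip_right] linear_neg[OF linear_ip_right] ip_scaleR_right ip_act_right

lemma ip_self_eq_0_iff [simp]: "ip x x = 0 \<longleftrightarrow> x = 0"
  by (simp add: ip_self)

lemma ip_eq_0_commute: "ip x y = 0 \<longleftrightarrow> ip y x = 0"
  by (subst ip_conj) simp

lemma norm_ip_commute: "norm (ip x y) = norm (ip y x)"
  by (subst ip_conj) simp

lemma norm_act: "norm (act q x) = norm q * norm x"
proof -
  have "ip (act q x) (act q x) = of_real ((norm x * norm q)\<^sup>2)"
  proof -
    have "ip (act q x) (act q x) = (qconj q * of_real ((norm x)\<^sup>2)) * q"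
      by (simp only: ip_act ip_act_right ip_self[of x] mult.assoc)
    \<comment> \<open>The middle factor is real, hence central, so the two outer factors
      meet.\<close>
    also have "\<dots> = of_real ((norm x)\<^sup>2) * (qconj q * q)"
      by (simp only: of_real_mult_commute_quat mult.assoc)
    finally show ?thesis
      by (simp add: qconj_mult_self qnorm2_eq_norm power_mult_distrib)
  qed
  then have "(norm (act q x))\<^sup>2 = (norm x * norm q)\<^sup>2"
    unfolding ip_self of_real_eq_iff .
  then show ?thesis
    by (simp add: power2_eq_iff_nonneg mult.commute)
qed

section \<open>Orthonormal systems, projections and Bessel's identity\<close>

definition orthonormal_on :: "'i set \<Rightarrow> ('i \<Rightarrow> 'a) \<Rightarrow> bool"
  where "orthonormal_on S f \<longleftrightarrow> (\<forall>a\<in>S. \<forall>b\<in>S. ip (f a) (f b) = (if a = b then 1 else 0))"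

definition proj :: "'i set \<Rightarrow> ('i \<Rightarrow> 'a) \<Rightarrow> 'a \<Rightarrow> 'a"
  where "proj S f x = (\<Sum>a\<in>S. act (ip x (f a)) (f a))"

lemma orthonormal_on_subset: "orthonormal_on S f \<Longrightarrow> T \<subseteq> S \<Longrightarrow> orthonormal_on T f"
  unfolding orthonormal_on_def by (meson subsetD)

lemma orthonormal_on_norm: "orthonormal_on S f \<Longrightarrow> a \<in> S \<Longrightarrow> norm (f a) = 1"
proof -
  assume "orthonormal_on S f" "a \<in> S"
  then have "of_real ((norm (f a))\<^sup>2) = (of_real 1 :: quat)"
    using ip_self[of "f a"] by (simp add: orthonormal_on_def)
  then have "(norm (f a))\<^sup>2 = 1"
    unfolding of_real_eq_iff .
  then show "norm (f a) = 1"
    using norm_ge_zero[of "f a"] by (auto simp: power2_eq_1_iff)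
qed

lemma ip_diff_proj:
  assumes "finite S" "orthonormal_on S f" "b \<in> S"
  shows "ip (x - proj S f x) (f b) = 0"
proof -
  have "ip (proj S f x) (f b) = (\<Sum>a\<in>S. ip (f a) (f b) * ip x (f a))"
    by (simp add: proj_def ip_linear_simps)
  also have "\<dots> = (\<Sum>a\<in>S. if b = a then ip x (f a) else 0)"
    using assms by (intro sum.cong) (auto simp: orthonormal_on_def)
  finally show ?thesis
    using assms by (simp add: ip_linear_simps)
qed

text \<open>The residual is orthogonal to the projection, so its squared norm is its inner product
  with \<open>x\<close>. Keeping the residual term gives Bessel's inequality in general and equality
  for vectors in the span.\<close>

lemma bessel_identity:
  assumes "finite S" "orthonormal_on S f"
  shows "(norm x)\<^sup>2 = (\<Sum>a\<in>S. (norm (ip x (f a)))\<^sup>2) + (norm (x - proj S f x))\<^sup>2"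
proof -
  define r where "r = x - proj S f x"
  have "ip r (f a) = 0" if "a \<in> S" for a
    unfolding r_def using ip_diff_proj[OF assms that] .
  then have "ip r (proj S f x) = 0"
    by (simp add: proj_def ip_linear_simps)
  then have "ip r (x - proj S f x) = ip r x"
    by (simp add: ip_linear_simps)
  then have "ip r r = ip r x"
    unfolding r_def .
  also have "\<dots> = ip x x - (\<Sum>a\<in>S. ip (f a) x * ip x (f a))"
    by (simp add: r_def proj_def ip_linear_simps)
  also have "(\<Sum>a\<in>S. ip (f a) x * ip x (f a)) = of_real (\<Sum>a\<in>S. (norm (ip x (f a)))\<^sup>2)"
  proof -
    have "ip (f a) x * ip x (f a) = of_real ((norm (ip x (f a)))\<^sup>2)" for a
      by (subst ip_conj) (simp add: qconj_mult_self qnorm2_eq_norm)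
    then show ?thesis by simp
  qed
  finally have "of_real ((norm r)\<^sup>2) = (of_real ((norm x)\<^sup>2 - (\<Sum>a\<in>S. (norm (ip x (f a)))\<^sup>2)) :: quat)"
    by (simp only: ip_self of_real_diff)
  then have "(norm r)\<^sup>2 = (norm x)\<^sup>2 - (\<Sum>a\<in>S. (norm (ip x (f a)))\<^sup>2)"
    unfolding of_real_eq_iff .
  then show ?thesis
    by (simp add: r_def)
qed

lemma orthonormal_on_singleton: "y \<noteq> 0 \<Longrightarrow> orthonormal_on {()} (\<lambda>_. y /\<^sub>R norm y)"
  by (simp add: orthonormal_on_def ip_self)

text \<open>Cauchy-Schwarz is Bessel's inequality for a single unit vector. It makes
  \<open>ip\<close> continuous.\<close>

lemma norm_ip_le: "norm (ip x y) \<le> norm x * norm y"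
proof (cases "y = 0")
  case False
  have "(norm (ip x (y /\<^sub>R norm y)))\<^sup>2 \<le> (norm x)\<^sup>2"
    using bessel_identity[OF _ orthonormal_on_singleton[OF False], of x] by simp
  then have "norm (ip x (y /\<^sub>R norm y)) \<le> norm x"
    by (rule power2_le_imp_le) simp
  then show ?thesis
    using False by (simp add: ip_scaleR_right field_simps)
qed (simp add: ip_linear_simps)

lemma bounded_bilinear_ip: "bounded_bilinear ip"
  by (rule bounded_bilinear.intro)
    (auto simp: ip_linear_simps intro!: exI[of _ 1] norm_ip_le)

lemma bounded_bilinear_act: "bounded_bilinear act"
  by (rule bounded_bilinear.intro)
    (auto simp: act_add_vec act_add_quat act_scaleR_vec act_scaleR_quat norm_act intro!: exI[of _ 1])

lemmas continuous_on_ip [continuous_intros] = bounded_bilinear.continuous_on[OF bounded_bilinear_ip]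
lemmas continuous_on_act [continuous_intros] = bounded_bilinear.continuous_on[OF bounded_bilinear_act]

text \<open>Double counting of the squared coefficients of the \<open>g b\<close> with respect to
  the \<open>f a\<close>: over \<open>a\<close> they sum to 1 for each \<open>b\<close>, since
  \<open>g b\<close> equals its projection; over \<open>b\<close> they sum to at most 1 for each
  \<open>a\<close>, by Bessel. This comparison takes the place of dimension theory over a division
  ring.\<close>

lemma orthonormal_on_card_le:
  assumes "finite S" "orthonormal_on S f" "finite T" "orthonormal_on T g"
    and "\<And>b. b \<in> T \<Longrightarrow> g b = proj S f (g b)"
  shows "card T \<le> card S"
proof -
  have "real (card T) = (\<Sum>b\<in>T. (norm (g b))\<^sup>2)"
    using orthonormal_on_norm[OF assms(4)] by simp
  also have "\<dots> = (\<Sum>b\<in>T. \<Sum>a\<in>S. (norm (ip (g b) (f a)))\<^sup>2)"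
  proof (rule sum.cong)
    show "(norm (g b))\<^sup>2 = (\<Sum>a\<in>S. (norm (ip (g b) (f a)))\<^sup>2)" if "b \<in> T" for b
      using bessel_identity[OF assms(1,2), of "g b"] assms(5)[OF that, symmetric] by simp
  qed simp
  also have "\<dots> = (\<Sum>a\<in>S. \<Sum>b\<in>T. (norm (ip (f a) (g b)))\<^sup>2)"
    by (subst sum.swap) (intro sum.cong arg_cong[of _ _ "\<lambda>x. x\<^sup>2"] refl norm_ip_commute)
  also have "\<dots> \<le> (\<Sum>a\<in>S. (norm (f a))\<^sup>2)"
  proof (rule sum_mono)
    show "(\<Sum>b\<in>T. (norm (ip (f a) (g b)))\<^sup>2) \<le> (norm (f a))\<^sup>2" for a
      using bessel_identity[OF assms(3,4), of "f a"] by simp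
  qed
  also have "\<dots> = real (card S)"
    using orthonormal_on_norm[OF assms(2)] by simp
  finally show ?thesis
    by simp
qed

text \<open>The system \<open>g\<close> certifies that the dimension is large enough. As long as the
  system built so far is smaller than \<open>g\<close>, some \<open>g b\<close> differs from its
  projection, and its normalised residual is the next vector.\<close>

lemma orthonormal_on_extend:
  assumes "finite T" "orthonormal_on T g" "finite S" "orthonormal_on S f"
    and "finite R" "S \<inter> R = {}" "card (S \<union> R) \<le> card T"
  shows "\<exists>h. orthonormal_on (S \<union> R) h \<and> (\<forall>a\<in>S. h a = f a)"
  using assms(5-7)
proof (induction R rule: finite_induct)
  case empty
  then show ?case using assms(4) by auto
next
  case (insert r R)
  have "finite (S \<union> R)" and r: "r \<notin> S \<union> R"
    using insert assms by auto
  then have less: "card (S \<union> R) < card T"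
    using insert.prems by simp
  then obtain h where h: "orthonormal_on (S \<union> R) h" "\<forall>a\<in>S. h a = f a"
    using insert by auto
  obtain b where "b \<in> T" "g b \<noteq> proj (S \<union> R) h (g b)"
    using orthonormal_on_card_le[OF \<open>finite (S \<union> R)\<close> h(1) assms(1,2)] less by (meson not_le)
  define y where "y = g b - proj (S \<union> R) h (g b)"
  have y: "ip y (h a) = 0" "ip (h a) y = 0" if "a \<in> S \<union> R" for a
    using ip_diff_proj[OF \<open>finite (S \<union> R)\<close> h(1) that] \<open>g b \<noteq> _\<close> ip_eq_0_commute by (auto simp: y_def)
  have "y \<noteq> 0"
    using \<open>g b \<noteq> _\<close> by (auto simp: y_def)
  then have "ip (y /\<^sub>R norm y) (y /\<^sub>R norm y) = 1"
    using orthonormal_on_singleton[of y] by (simp add: orthonormal_on_def)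
  then have "orthonormal_on (S \<union> insert r R) (h(r := y /\<^sub>R norm y))"
    using h(1) r y by (auto simp: orthonormal_on_def ip_scaleR ip_scaleR_right)
  moreover have "\<forall>a\<in>S. (h(r := y /\<^sub>R norm y)) a = f a"
    using h(2) r by auto
  ultimately show ?case
    by blast
qed

end

section \<open>Polynomial curves and Baire category\<close>

text \<open>Polynomials in one real variable with coefficients in an arbitrary real vector space.
  The inductive form reduces closure under linear and bilinear maps to monomials, in any
  dimension.\<close>

inductive poly_curve :: "(real \<Rightarrow> 'v::real_vector) \<Rightarrow> bool" where
  monom: "poly_curve (\<lambda>t. t ^ n *\<^sub>R c)"
| add: "poly_curve f \<Longrightarrow> poly_curve g \<Longrightarrow> poly_curve (\<lambda>t. f t + g t)"

lemma poly_curve_const: "poly_curve (\<lambda>_. c)"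
  using poly_curve.monom[of 0 c] by simp

lemma poly_curve_sum: "(\<And>i. i \<in> I \<Longrightarrow> poly_curve (f i)) \<Longrightarrow> poly_curve (\<lambda>t. \<Sum>i\<in>I. f i t)"
  by (induction I rule: infinite_finite_induct) (auto intro: poly_curve.add poly_curve_const)

lemma poly_curve_linear: "poly_curve f \<Longrightarrow> linear L \<Longrightarrow> poly_curve (\<lambda>t. L (f t))"
  by (induction rule: poly_curve.induct)
    (simp_all add: linear_add linear_scale poly_curve.intros)

lemma poly_curve_diff: "poly_curve f \<Longrightarrow> poly_curve g \<Longrightarrow> poly_curve (\<lambda>t. f t - g t)"
  using poly_curve.add[of f "\<lambda>t. - g t"] poly_curve_linear[of g uminus]
  by (simp add: linear_uminus)

text \<open>The common source of the closure rules for scaling, \<open>ip\<close> and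
  \<open>act\<close>; induction on both curves leaves a product of two monomials.\<close>

lemma poly_curve_bilinear:
  assumes "poly_curve f" "poly_curve g"
    and left: "\<And>y. linear (\<lambda>x. B x y)" and right: "\<And>x. linear (B x)"
  shows "poly_curve (\<lambda>t. B (f t) (g t))"
  using assms(1,2)
proof (induction arbitrary: g rule: poly_curve.induct)
  case (monom n c)
  then show ?case
  proof (induction rule: poly_curve.induct)
    case (monom m d)
    then show ?case
      using poly_curve.monom[of "n + m" "B c d"]
      by (simp add: linear_scale[OF left] linear_scale[OF right] power_add mult.commute)
  next
    case (add f g)
    then show ?case
      using poly_curve.add[OF add.IH] by (simp add: linear_add[OF right])
  qed
next
  case (add f1 f2)
  then show ?case
    using poly_curve.add[OF add.IH(1)[OF add.prems] add.IH(2)[OF add.prems]]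
    by (simp add: linear_add[OF left])
qed

lemma poly_curve_scaleR: "poly_curve f \<Longrightarrow> poly_curve g \<Longrightarrow> poly_curve (\<lambda>t. f t *\<^sub>R g t)"
  by (rule poly_curve_bilinear[where B = scaleR]) (auto intro!: linearI simp: algebra_simps)

lemma poly_curve_prod:
  fixes f :: "'i \<Rightarrow> real \<Rightarrow> real"
  shows "(\<And>i. i \<in> I \<Longrightarrow> poly_curve (f i)) \<Longrightarrow> poly_curve (\<lambda>t. \<Prod>i\<in>I. f i t)"
proof (induction I rule: infinite_finite_induct)
  case (insert i I)
  then have "poly_curve (\<lambda>t. f i t *\<^sub>R (\<Prod>i\<in>I. f i t))"
    by (intro poly_curve_scaleR) auto
  then show ?case
    using insert by simp
qed (auto intro: poly_curve_const)

lemma poly_curve_real: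
  assumes "poly_curve (f :: real \<Rightarrow> real)"
  shows "\<exists>p. f = poly p"
  using assms
proof (induction rule: poly_curve.induct)
  case (monom n c)
  have "(\<lambda>t. t ^ n *\<^sub>R c) = poly (Polynomial.monom c n)"
    by (simp add: fun_eq_iff poly_monom)
  then show ?case ..
next
  case (add f g)
  then obtain p q where "f = poly p" "g = poly q" by auto
  then have "(\<lambda>t. f t + g t) = poly (p + q)"
    by (simp add: fun_eq_iff)
  then show ?case ..
qed

text \<open>Pairing with the nonzero vector \<open>f s\<close> gives a real polynomial that is
  nonzero at \<open>s\<close> and vanishes wherever \<open>f\<close> does.\<close>

lemma poly_curve_finite_zeros:
  fixes f :: "real \<Rightarrow> 'v::real_inner"
  assumes "poly_curve f" "f s \<noteq> 0"
  shows "finite {t. f t = 0}"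
proof -
  have "linear (\<lambda>x. inner x (f s))"
    by (simp add: bounded_linear.linear bounded_linear_inner_left)
  then obtain p where p: "(\<lambda>t. inner (f t) (f s)) = poly p"
    using poly_curve_real[OF poly_curve_linear[OF assms(1)]] by blast
  have "poly p s \<noteq> 0"
    using assms(2) by (simp flip: p)
  then have "p \<noteq> 0"
    by auto
  then have "finite {t. poly p t = 0}"
    by (rule poly_roots_finite)
  moreover have "{t. f t = 0} \<subseteq> {t. poly p t = 0}"
    by (auto simp flip: p)
  ultimately show ?thesis
    by (rule rev_finite_subset)
qed

text \<open>To be applied to the space of sequences \<open>nat \<Rightarrow> 'a\<close> with its
  product topology.\<close>

lemma closure_Inter_countable_dense:
  fixes \<G> :: "'b::complete_space set set"
  assumes "countable \<G>" "\<And>U. U \<in> \<G> \<Longrightarrow> open U \<and> closure U = UNIV"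
  shows "closure (\<Inter>\<G>) = UNIV"
  using Baire_category[of "euclidean :: 'b topology" \<G>] assms
  by (simp add: completely_metrizable_space_euclidean)

text \<open>Intersecting these sets over a countable dense set of points \<open>d\<close> and radii
  tending to 0 leaves the sequences with dense range. Each is dense because changing only the entry
  at \<open>m\<close> gives sequences that converge to \<open>v\<close> coordinatewise as
  \<open>m\<close> grows.\<close>

lemma dense_some_coordinate_near:
  fixes d :: "'b::metric_space"
  assumes "e > 0"
  shows "open {v :: nat \<Rightarrow> 'b. \<exists>i. dist (v i) d < e}"
    and "closure {v :: nat \<Rightarrow> 'b. \<exists>i. dist (v i) d < e} = UNIV"
proof -
  have "open {v :: nat \<Rightarrow> 'b. dist (v i) d < e}" for i
    by (intro open_Collect_less continuous_intros continuous_on_product_coordinates)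
  then have "open (\<Union>i. {v :: nat \<Rightarrow> 'b. dist (v i) d < e})"
    by blast
  then show "open {v :: nat \<Rightarrow> 'b. \<exists>i. dist (v i) d < e}"
    by (simp add: Collect_ex_eq)
  have "v \<in> closure {v. \<exists>i. dist (v i) d < e}" for v :: "nat \<Rightarrow> 'b"
    unfolding closure_sequential
  proof (intro exI conjI allI)
    fix m
    show "v(m := d) \<in> {v. \<exists>i. dist (v i) d < e}"
      using assms by (auto intro: exI[of _ m])
  next
    have "(\<lambda>m. (v(m := d)) i) \<longlonglongrightarrow> v i" for i
      by (rule tendsto_eventually, rule eventually_sequentiallyI[of "Suc i"]) auto
    then have "limitin (product_topology (\<lambda>_. euclidean) UNIV) (\<lambda>m. v(m := d)) v sequentially"
      by (simp add: limitin_componentwise)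
    then show "(\<lambda>m. v(m := d)) \<longlonglongrightarrow> v"
      by (simp add: euclidean_product_topology)
  qed
  then show "closure {v :: nat \<Rightarrow> 'b. \<exists>i. dist (v i) d < e} = UNIV"
    by blast
qed

lemma closure_Compl_finite:
  fixes Z :: "real set"
  assumes "finite Z"
  shows "closure (- Z) = UNIV"
  using empty_interior_finite[OF assms] by (simp add: closure_complement)

section \<open>Generic orthonormal bases\<close>

context right_quat_hilbert
begin

section \<open>Nonzero entries for a single operator\<close>

lemma ip_image_self_nonzero:
  assumes T: "bounded_quat_linear act T" and "\<not> realscalar_op T"
  shows "\<exists>x. ip (T x) x \<noteq> 0"
proof (rule ccontr)
  have lin: "linear T" and T_act: "\<And>q x. T (act q x) = act q (T x)"
    using T by (auto simp: bounded_quat_linear_def bounded_linear.linear)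
  assume "\<nexists>x. ip (T x) x \<noteq> 0"
  then have self: "ip (T x) x = 0" for x by auto
  have anti: "ip (T x) y + ip (T y) x = 0" for x y
    using self[of "x + y"] self[of x] self[of y] by (simp add: linear_add[OF lin] ip_linear_simps add.commute)
  have "ip (T x) y = 0" for x y
  proof -
    define a where "a = ip (T x) y"
    have "ip (T y) x = - a"
      using anti[of x y] by (simp add: a_def add_eq_0_iff)
    \<comment> \<open>Antisymmetry is applied with \<open>act q x\<close> in place of
      \<open>x\<close>. For the three imaginary units it says that \<open>a\<close> anticommutes
      with each of them, which forces \<open>a = 0\<close>.\<close>
    then have "a * q = qconj q * a" for q
      using anti[of "act q x" y] by (simp add: T_act ip_act ip_act_right a_def)
    from this[of "Quat 0 1 0 0"] this[of "Quat 0 0 1 0"] this[of "Quat 0 0 0 1"]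
    have "a = 0"
      by (simp add: quat_eq_iff)
    then show ?thesis
      by (simp add: a_def)
  qed
  then have "T x = 0" for x
    using ip_self_eq_0_iff by blast
  then have "T = (\<lambda>x. 0 *\<^sub>R x)"
    by auto
  then show False
    using assms(2) unfolding realscalar_op_def by blast
qed

text \<open>The pair \<open>e\<close>, \<open>f\<close> secures dimension at least two; in dimension
  one there are no orthogonal unit vectors to choose.\<close>

lemma ip_image_orthogonal_nonzero:
  assumes T: "bounded_quat_linear act T" and nonscalar: "\<not> realscalar_op T"
    and ef: "norm e = 1" "norm f = 1" "ip e f = 0"
  shows "\<exists>x y. norm x = 1 \<and> norm y = 1 \<and> ip x y = 0 \<and> ip (T x) y \<noteq> 0"
proof (rule ccontr)
  have lin: "linear T" and T_act: "\<And>q x. T (act q x) = act q (T x)"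
    using T by (auto simp: bounded_quat_linear_def bounded_linear.linear)
  assume contra: "\<not> ?thesis"
  have orth: "ip (T x) y = 0" if "ip x y = 0" for x y
  proof (cases "x = 0 \<or> y = 0")
    case False
    then have "norm (x /\<^sub>R norm x) = 1" "norm (y /\<^sub>R norm y) = 1"
      and "ip (x /\<^sub>R norm x) (y /\<^sub>R norm y) = 0"
      using that by (simp_all add: ip_scaleR ip_scaleR_right)
    then have "ip (T (x /\<^sub>R norm x)) (y /\<^sub>R norm y) = 0"
      using contra by blast
    then show ?thesis
      using False by (simp add: linear_scale[OF lin] ip_scaleR ip_scaleR_right)
  qed (auto simp: linear_0[OF lin] ip_linear_simps)
  have unit: "ip x x = 1" if "norm x = 1" for x
    using that by (simp add: ip_self)
  have eq: "ip (T x) x = ip (T y) y" if "norm x = 1" "norm y = 1" "ip x y = 0" for x y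
  proof -
    have "ip y x = 0"
      using that ip_eq_0_commute by blast
    \<comment> \<open>The sum and the difference of orthogonal unit vectors are orthogonal. Once the
      mixed terms are removed, the assumption at this pair compares the two diagonal values.\<close>
    then have "ip (x + y) (x - y) = 0"
      using that by (simp add: ip_linear_simps unit)
    then have "ip (T (x + y)) (x - y) = 0"
      by (rule orth)
    moreover have "ip (T x) y = 0" "ip (T y) x = 0"
      using orth that(3) \<open>ip y x = 0\<close> by auto
    ultimately show ?thesis
      by (simp add: linear_add[OF lin] ip_linear_simps)
  qed
  \<comment> \<open>The residual \<open>y\<close> is orthogonal to \<open>x\<close>, hence to
    \<open>T x\<close> by \<open>orth\<close>, hence to itself.\<close>
  have image: "T x = act (ip (T x) x) x" if "norm x = 1" for x
  proof -
    define y where "y = T x - act (ip (T x) x) x"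
    have "ip y x = 0"
      using that by (simp add: y_def ip_linear_simps unit)
    then have "ip x y = 0"
      using ip_eq_0_commute by blast
    then have "ip (T x) y = 0"
      by (rule orth)
    then have "ip (T x - act (ip (T x) x) x) y = 0"
      using \<open>ip x y = 0\<close> by (simp add: ip_linear_simps)
    then have "y = 0"
      unfolding y_def[symmetric] by simp
    then show ?thesis
      by (simp add: y_def)
  qed
  define a where "a = ip (T f) f"
  have "ip (T e) e = qconj q * (a * q)" if "norm q = 1" for q
    using eq[of e "act q f"] ef that
    by (simp add: norm_act ip_linear_simps T_act a_def mult.assoc)
  then have "qconj q * (a * q) = a" if "norm q = 1" for q
    using that eq[OF ef] by (simp add: a_def)
  \<comment> \<open>For a unit quaternion \<open>q\<close> the equation says that \<open>a\<close>
    commutes with \<open>q\<close>; the units i and j already make \<open>a\<close> real.\<close>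
  from this[of "Quat 0 1 0 0"] this[of "Quat 0 0 1 0"]
  have "im_i a = 0 \<and> im_j a = 0 \<and> im_k a = 0"
    by (simp add: norm_quat_def qnorm2_def quat_eq_iff)
  then have a: "a = of_real (re a)"
    by (simp add: quat_eq_iff[of a])
  have Te: "T e = re a *\<^sub>R e"
    using image[OF ef(1)] eq[OF ef] a act_of_real[of "re a" e] by (simp add: a_def)
  have perp: "T z = re a *\<^sub>R z" if "ip e z = 0" for z
  proof (cases "z = 0")
    case False
    define u where "u = z /\<^sub>R norm z"
    have u: "norm u = 1" "ip e u = 0"
      using False that by (simp_all add: u_def ip_scaleR_right)
    have "ip (T u) u = of_real (re a)"
      using eq[OF ef(1) u] eq[OF ef] a by (simp add: a_def)
    then have "T u = re a *\<^sub>R u"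
      using image[OF u(1)] act_of_real[of "re a" u] by simp
    then have "T (norm z *\<^sub>R u) = re a *\<^sub>R (norm z *\<^sub>R u)"
      by (simp add: linear_scale[OF lin])
    moreover have z: "z = norm z *\<^sub>R u"
      using False by (simp add: u_def)
    ultimately show ?thesis
      unfolding z[symmetric] by simp
  qed (simp add: linear_0[OF lin])
  \<comment> \<open>Every vector splits into a multiple of \<open>e\<close> and a part orthogonal to
    \<open>e\<close>, and \<open>T\<close> acts by the same real number on both.\<close>
  have "T x = re a *\<^sub>R x" for x
  proof -
    define b where "b = ip x e"
    have "ip (x - act b e) e = 0"
      using ef by (simp add: b_def ip_linear_simps unit)
    then have "T (x - act b e) = re a *\<^sub>R (x - act b e)"
      using ip_eq_0_commute perp by blast
    then show ?thesis
      by (simp add: linear_diff[OF lin] T_act Te act_scaleR_vec scaleR_right_diff_distrib)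
  qed
  then show False
    using nonscalar by (auto simp: realscalar_op_def)
qed

text \<open>A vector (if \<open>i = j\<close>) or an orthonormal pair with nonzero entry is placed
  at the indices \<open>i\<close>, \<open>j\<close> and completed to all indices up to
  \<open>m\<close>; \<open>g\<close> guarantees that there is room.\<close>

lemma orthonormal_on_witness:
  assumes T: "bounded_quat_linear act T" and nonscalar: "\<not> realscalar_op T"
    and g: "orthonormal_on {..m::nat} g" and ij: "i \<le> m" "j \<le> m"
  shows "\<exists>h. orthonormal_on {..m} h \<and> ip (T (h i)) (h j) \<noteq> 0"
proof -
  have lin: "linear T"
    using T by (auto simp: bounded_quat_linear_def bounded_linear.linear)
  have "\<exists>f. orthonormal_on {i, j} f \<and> ip (T (f i)) (f j) \<noteq> 0"
  proof (cases "i = j")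
    case True
    obtain x where x: "ip (T x) x \<noteq> 0"
      using ip_image_self_nonzero[OF T nonscalar] by blast
    then have "x \<noteq> 0"
      by (auto simp: ip_linear_simps)
    then have "orthonormal_on {i, j} (\<lambda>_. x /\<^sub>R norm x)"
      using True orthonormal_on_singleton[of x] by (simp add: orthonormal_on_def)
    then show ?thesis
      using x \<open>x \<noteq> 0\<close>
      by (intro exI[of _ "\<lambda>_. x /\<^sub>R norm x"]) (simp add: linear_scale[OF lin] ip_linear_simps)
  next
    case False
    have "ip (g i) (g j) = 0" "norm (g i) = 1" "norm (g j) = 1"
      using g ij False orthonormal_on_norm[OF g] by (auto simp: orthonormal_on_def)
    then obtain x y where xy: "norm x = 1" "norm y = 1" "ip x y = 0" "ip (T x) y \<noteq> 0"
      using ip_image_orthogonal_nonzero[OF T nonscalar] by blast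
    then have "orthonormal_on {i, j} ((\<lambda>_. y)(i := x))"
      using False ip_eq_0_commute[of x y] by (simp add: orthonormal_on_def ip_self)
    then show ?thesis
      using xy False by (intro exI[of _ "(\<lambda>_. y)(i := x)"]) simp
  qed
  then obtain f where f: "orthonormal_on {i, j} f" "ip (T (f i)) (f j) \<noteq> 0"
    by blast
  have "{i, j} \<union> ({..m} - {i, j}) = {..m}"
    using ij by auto
  then obtain h where "orthonormal_on {..m} h" "\<forall>a\<in>{i, j}. h a = f a"
    using orthonormal_on_extend[OF _ g _ f(1), of "{..m} - {i, j}"] by auto
  then show ?thesis
    using f(2) by auto
qed

text \<open>
  Gram--Schmidt without division, so that the entries are polynomial in \<open>v\<close>. The price is that
  all entries after a zero entry vanish.
\<close>

fun gs :: "(nat \<Rightarrow> 'a) \<Rightarrow> nat \<Rightarrow> 'a" where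
  "gs v n = (\<Prod>j<n. (norm (gs v j))\<^sup>2) *\<^sub>R v n
     - (\<Sum>i<n. (\<Prod>j\<in>{..<n} - {i}. (norm (gs v j))\<^sup>2) *\<^sub>R act (ip (v n) (gs v i)) (gs v i))"

declare gs.simps [simp del]

text \<open>In the inner product of entry \<open>n\<close> with an earlier entry \<open>l\<close>
  only the summand \<open>i = l\<close> survives. The squared norm of entry \<open>l\<close>
  restores the factor missing from its product, so it cancels the leading term even if some entries
  vanish.\<close>

lemma ip_gs: "i \<noteq> j \<Longrightarrow> ip (gs v i) (gs v j) = 0"
proof -
  have less: "l < n \<Longrightarrow> ip (gs v n) (gs v l) = 0" for l n
  proof (induction n arbitrary: l rule: less_induct)
    case (less n)
    let ?D = "\<lambda>S. \<Prod>j\<in>S. (norm (gs v j))\<^sup>2"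
    have orth: "ip (gs v i) (gs v l) = 0" if "i < n" "i \<noteq> l" for i
    proof (cases "i < l")
      case True
      then show ?thesis
        using less.IH[of l i] less.prems ip_eq_0_commute by blast
    next
      case False
      then show ?thesis
        using less.IH[of i l] that by simp
    qed
    have "(\<Sum>i<n. ?D ({..<n} - {i}) *\<^sub>R (ip (gs v i) (gs v l) * ip (v n) (gs v i)))
        = (\<Sum>i<n. if l = i then ?D ({..<n} - {l}) *\<^sub>R (ip (gs v l) (gs v l) * ip (v n) (gs v l)) else 0)"
      using orth by (intro sum.cong) auto
    also have "\<dots> = ?D ({..<n} - {l}) *\<^sub>R (ip (gs v l) (gs v l) * ip (v n) (gs v l))"
      using less.prems by simp
    also have "\<dots> = (?D ({..<n} - {l}) * (norm (gs v l))\<^sup>2) *\<^sub>R ip (v n) (gs v l)"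
      by (simp add: ip_self scaleR_conv_of_real mult.assoc)
    also have "?D ({..<n} - {l}) * (norm (gs v l))\<^sup>2 = ?D {..<n}"
      using prod.remove[of "{..<n}" l "\<lambda>j. (norm (gs v j))\<^sup>2"] less.prems by (simp add: mult.commute)
    finally show ?case
      by (subst gs.simps) (simp add: ip_linear_simps)
  qed
  assume "i \<noteq> j"
  then show ?thesis
    using less[of i j] less[of j i] ip_eq_0_commute by (cases i j rule: linorder_cases) auto
qed

text \<open>All products are 1 and all corrections vanish. Hence an orthonormal witness is also a
  witness for its own Gram-Schmidt vectors.\<close>

lemma gs_orthonormal:
  assumes "orthonormal_on {..m} v" "n \<le> m"
  shows "gs v n = v n"
  using assms(2)
proof (induction n rule: less_induct)
  case (less n)
  have gs: "gs v i = v i" if "i < n" for i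
    using less that by auto
  have "norm (v i) = 1" if "i < n" for i
    using orthonormal_on_norm[OF assms(1)] that less.prems by auto
  moreover have "ip (v n) (v i) = 0" if "i < n" for i
    using assms(1) that less.prems by (auto simp: orthonormal_on_def)
  ultimately show ?case
    by (subst gs.simps) (simp add: gs)
qed

lemma gs_cong: "(\<And>i. i \<le> n \<Longrightarrow> u i = v i) \<Longrightarrow> gs u n = gs v n"
proof (induction n rule: less_induct)
  case (less n)
  then have "gs u i = gs v i" if "i < n" for i
    using that by auto
  then show ?case
    using less.prems by (subst (1 2) gs.simps) (simp cong: prod.cong_simp)
qed

lemma gs_eq_0_mono:
  assumes "gs v i = 0" "i \<le> n"
  shows "gs v n = 0"
proof (cases "i = n")
  case False
  then have "i < n" using assms by simp
  then have "(\<Prod>j<n. (norm (gs v j))\<^sup>2) = 0"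
    using assms by (auto simp: prod_zero_iff)
  \<comment> \<open>The zero factor at \<open>i\<close> kills every summand except
    \<open>l = i\<close>, which contains \<open>gs v i\<close> itself.\<close>
  moreover have "(\<Prod>j\<in>{..<n} - {l}. (norm (gs v j))\<^sup>2) *\<^sub>R act (ip (v n) (gs v l)) (gs v l) = 0" for l
    using assms \<open>i < n\<close> by (cases "i = l") (auto simp: prod_zero_iff)
  ultimately show ?thesis
    by (subst gs.simps) (simp only: scaleR_zero_left sum.neutral_const diff_self)
qed (use assms in simp)

section \<open>Continuity of Gram-Schmidt vectors and their behaviour along lines\<close>

lemma continuous_on_gs: "continuous_on UNIV (\<lambda>v. gs v n)"
proof (induction n rule: less_induct)
  case (less n)
  then show ?case
    by (subst gs.simps) (auto intro!: continuous_intros)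
qed

lemma poly_curve_ip: "poly_curve f \<Longrightarrow> poly_curve g \<Longrightarrow> poly_curve (\<lambda>t. ip (f t) (g t))"
  by (rule poly_curve_bilinear) (auto intro: linear_ip_left linear_ip_right)

lemma poly_curve_act: "poly_curve f \<Longrightarrow> poly_curve g \<Longrightarrow> poly_curve (\<lambda>t. act (f t) (g t))"
  by (rule poly_curve_bilinear) (auto intro: linear_act_vec linear_act_quat)

text \<open>The norm is not polynomial but its square is, which is why \<open>gs\<close> is built
  from squared norms.\<close>

lemma poly_curve_norm_square: "poly_curve f \<Longrightarrow> poly_curve (\<lambda>t. (norm (f t))\<^sup>2)"
  for f :: "real \<Rightarrow> 'a"
proof -
  assume "poly_curve f"
  then have "poly_curve (\<lambda>t. re (ip (f t) (f t)))"
    by (intro poly_curve_linear[where L = re] poly_curve_ip linearI) auto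
  then show ?thesis
    by (simp add: ip_self flip: of_real_power)
qed

lemma poly_curve_gs: "poly_curve (\<lambda>t. gs (\<lambda>i. v i + t *\<^sub>R w i) n)"
proof (induction n rule: less_induct)
  case (less n)
  define g where "g = (\<lambda>i t. gs (\<lambda>i. v i + t *\<^sub>R w i) i)"
  have g: "poly_curve (g i)" if "i < n" for i
    using less.IH[OF that] by (simp add: g_def)
  have v: "poly_curve (\<lambda>t. v n + t *\<^sub>R w n)"
    using poly_curve.add[OF poly_curve_const[of "v n"] poly_curve.monom[of 1 "w n"]]
    unfolding power_one_right .
  have prod: "poly_curve (\<lambda>t. \<Prod>j\<in>J. (norm (g j t))\<^sup>2)" if "J \<subseteq> {..<n}" for J
  proof (rule poly_curve_prod, rule poly_curve_norm_square)
    show "poly_curve (g j)" if "j \<in> J" for j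
      using \<open>J \<subseteq> {..<n}\<close> that g by blast
  qed
  have "poly_curve (\<lambda>t. (\<Prod>j<n. (norm (g j t))\<^sup>2) *\<^sub>R (v n + t *\<^sub>R w n)
     - (\<Sum>i<n. (\<Prod>j\<in>{..<n} - {i}. (norm (g j t))\<^sup>2) *\<^sub>R act (ip (v n + t *\<^sub>R w n) (g i t)) (g i t)))"
    by (intro poly_curve_diff poly_curve_scaleR[OF prod v] poly_curve_sum
        poly_curve_scaleR[OF prod poly_curve_act[OF poly_curve_ip[OF v g] g]]) auto
  then show ?case
    unfolding g_def by (subst gs.simps)
qed

lemma gs_generic:
  assumes T: "bounded_linear T" and u: "ip (T (gs u i)) (gs u j) \<noteq> 0"
  shows "open {v. ip (T (gs v i)) (gs v j) \<noteq> 0}"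
    and "closure {v. ip (T (gs v i)) (gs v j) \<noteq> 0} = UNIV"
proof -
  let ?S = "{v. ip (T (gs v i)) (gs v j) \<noteq> 0}"
  have "continuous_on UNIV (\<lambda>v. ip (T (gs v i)) (gs v j))"
    by (intro continuous_intros bounded_linear.continuous_on[OF T] continuous_on_gs)
  then show "open ?S"
    by (rule open_Collect_neq) (rule continuous_on_const)
  have "v \<in> closure ?S" for v
  proof -
    \<comment> \<open>The line that passes through \<open>v\<close> at 0 and through the witness
      \<open>u\<close> at 1. All but finitely many of its points lie in the set, so \<open>v\<close>
      is a limit of such points.\<close>
    define c where "c = (\<lambda>t::real. \<lambda>n. v n + t *\<^sub>R (u n - v n))"
    have "poly_curve (\<lambda>t. ip (T (gs (c t) i)) (gs (c t) j))"
      unfolding c_def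
      by (rule poly_curve_ip[OF poly_curve_linear[OF poly_curve_gs bounded_linear.linear[OF T]] poly_curve_gs])
    moreover have "c 1 = u"
      by (simp add: c_def)
    ultimately have "finite {t. ip (T (gs (c t) i)) (gs (c t) j) = 0}" (is "finite ?Z")
      using u by (intro poly_curve_finite_zeros[where s = 1]) simp_all
    then have "closure (- ?Z) = UNIV"
      by (rule closure_Compl_finite)
    moreover have "continuous_on UNIV c"
      unfolding c_def by (intro continuous_on_coordinatewise_then_product continuous_intros)
    moreover have "c ` (- ?Z) \<subseteq> closure ?S"
      by (intro order_trans[OF _ closure_subset]) auto
    ultimately have "c ` UNIV \<subseteq> closure ?S"
      using image_closure_subset[of "- ?Z" c "closure ?S"] by simp
    then have "c 0 \<in> closure ?S"
      by blast
    then show ?thesis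
      by (simp add: c_def)
  qed
  then show "closure ?S = UNIV"
    by blast
qed

section \<open>The quaternionic span\<close>

lemma quat_span_base: "x \<in> S \<Longrightarrow> x \<in> quat_span act S"
  unfolding quat_span_def by (intro CollectI exI[of _ "{x}"] exI[of _ "\<lambda>_. 1"]) simp

lemma quat_span_0: "0 \<in> quat_span act S"
  unfolding quat_span_def by (intro CollectI exI[of _ "{}"]) simp

lemma quat_span_act: "x \<in> quat_span act S \<Longrightarrow> act q x \<in> quat_span act S"
proof -
  assume "x \<in> quat_span act S"
  then obtain F c where F: "finite F" "F \<subseteq> S" and x: "x = (\<Sum>y\<in>F. act (c y) y)"
    by (auto simp: quat_span_def)
  have "act q x = (\<Sum>y\<in>F. act (c y * q) y)"
    by (simp add: x linear_sum[OF linear_act_vec] act_act)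
  then show ?thesis
    using F unfolding quat_span_def by (intro CollectI exI[of _ F] exI[of _ "\<lambda>y. c y * q"]) simp
qed

lemma quat_span_add:
  assumes "x \<in> quat_span act S" "y \<in> quat_span act S"
  shows "x + y \<in> quat_span act S"
proof -
  obtain F c where F: "finite F" "F \<subseteq> S" and x: "x = (\<Sum>z\<in>F. act (c z) z)"
    using assms(1) by (auto simp: quat_span_def)
  obtain G d where G: "finite G" "G \<subseteq> S" and y: "y = (\<Sum>z\<in>G. act (d z) z)"
    using assms(2) by (auto simp: quat_span_def)
  define b where "b z = (if z \<in> F then c z else 0) + (if z \<in> G then d z else 0)" for z
  have "x = (\<Sum>z\<in>F \<union> G. act (if z \<in> F then c z else 0) z)"
    unfolding x using F G by (intro sum.mono_neutral_cong_left) auto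
  moreover have "y = (\<Sum>z\<in>F \<union> G. act (if z \<in> G then d z else 0) z)"
    unfolding y using F G by (intro sum.mono_neutral_cong_left) auto
  ultimately have "x + y = (\<Sum>z\<in>F \<union> G. act (b z) z)"
    unfolding b_def by (simp only: act_add_quat sum.distrib)
  moreover have "finite (F \<union> G)" "F \<union> G \<subseteq> S"
    using F G by auto
  ultimately show ?thesis
    unfolding quat_span_def by blast
qed

lemma quat_span_scaleR: "x \<in> quat_span act S \<Longrightarrow> r *\<^sub>R x \<in> quat_span act S"
  using quat_span_act[of x S "of_real r"] by (simp add: act_of_real)

lemma quat_span_sum: "(\<And>i. i \<in> I \<Longrightarrow> f i \<in> quat_span act S) \<Longrightarrow> sum f I \<in> quat_span act S"
  by (induction I rule: infinite_finite_induct) (auto intro: quat_span_0 quat_span_add)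

section \<open>The generic basis of a right space\<close>

theorem exists_orthonormal_basis_nonzero_entries:
  fixes A :: "nat \<Rightarrow> 'a \<Rightarrow> 'a"
  assumes sep: "separable_space (euclidean :: 'a topology)"
    and A: "\<And>k. bounded_quat_linear act (A k)" "\<And>k. \<not> realscalar_op (A k)"
  shows "\<exists>E. orthonormal_basis act ip E \<and> (\<forall>e\<in>E. \<forall>e'\<in>E. \<forall>k. ip (A k e) e' \<noteq> 0)"
proof -
  obtain D :: "'a set" where D: "countable D" "closure D = UNIV"
    using sep unfolding separable_space_def by auto
  define P where "P = (\<lambda>(T, i, j). {v. ip (T (gs v i)) (gs v j) \<noteq> 0})"
  define N where "N = (\<lambda>(d :: 'a, n :: nat). {v :: nat \<Rightarrow> 'a. \<exists>i. dist (v i) d < inverse (real (Suc n))})"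
  \<comment> \<open>Including \<open>id\<close> makes the nonvanishing of a Gram-Schmidt vector
    itself a generic condition. Empty sets are removed because some entries vanish for every
    sequence, for instance at indices beyond the dimension.\<close>
  define \<G> where "\<G> = (P ` (insert id (range A) \<times> UNIV) - {{}}) \<union> N ` (D \<times> UNIV)"
  have blin: "bounded_linear T" if "T \<in> insert id (range A)" for T
    using that A(1) by (auto simp: bounded_quat_linear_def id_def intro: bounded_linear_ident)
  have "countable \<G>"
    unfolding \<G>_def using D(1) by (intro countable_Un countable_Diff countable_image countable_SIGMA) auto
  moreover have "open U \<and> closure U = UNIV" if "U \<in> \<G>" for U
  proof -
    have "U \<in> P ` (insert id (range A) \<times> UNIV) - {{}} \<or> U \<in> N ` (D \<times> UNIV)"
      using that unfolding \<G>_def Un_iff .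
    then show ?thesis
    proof
      assume "U \<in> P ` (insert id (range A) \<times> UNIV) - {{}}"
      then obtain w where "w \<in> insert id (range A) \<times> UNIV" "U = P w" "U \<noteq> {}"
        by blast
      moreover obtain T i j where "w = (T, i, j)"
        by (cases w)
      ultimately have T: "T \<in> insert id (range A)" and U: "U = P (T, i, j)" "U \<noteq> {}"
        by simp_all
      then obtain u where "ip (T (gs u i)) (gs u j) \<noteq> 0"
        by (auto simp: P_def)
      then show ?thesis
        unfolding U(1) P_def prod.case by (intro conjI gs_generic[OF blin[OF T]])
    next
      assume "U \<in> N ` (D \<times> UNIV)"
      then obtain d n where U: "U = N (d, n)"
        by blast
      have "inverse (real (Suc n)) > 0"
        by simp
      then show ?thesis
        unfolding U N_def prod.case by (intro conjI dense_some_coordinate_near)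
    qed
  qed
  ultimately have "closure (\<Inter>\<G>) = UNIV"
    by (rule closure_Inter_countable_dense)
  then have "\<Inter>\<G> \<noteq> {}"
    by auto
  then obtain v where v: "v \<in> \<Inter>\<G>"
    by blast
  \<comment> \<open>The chosen \<open>v\<close> is as good as any other sequence: what is nonzero
    for some \<open>u\<close> is nonzero for \<open>v\<close>.\<close>
  have generic: "ip (T (gs v i)) (gs v j) \<noteq> 0"
    if "T \<in> insert id (range A)" "ip (T (gs u i)) (gs u j) \<noteq> 0" for T u i j
  proof -
    have "u \<in> P (T, i, j)"
      using that by (simp add: P_def)
    then have "P (T, i, j) \<in> \<G>"
      unfolding \<G>_def using that(1) by blast
    then have "v \<in> P (T, i, j)"
      using v by blast
    then show ?thesis
      by (simp add: P_def)
  qed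
  have dense: "closure (range v) = UNIV"
  proof -
    have "\<exists>y\<in>range v. dist y x < e" if "e > 0" for x e
    proof -
      have "x \<in> closure D" "e / 2 > 0"
        using D \<open>e > 0\<close> by auto
      then obtain d where d: "d \<in> D" "dist d x < e / 2"
        unfolding closure_approachable by blast
      obtain n where n: "inverse (real (Suc n)) < e / 2"
        using reals_Archimedean \<open>e / 2 > 0\<close> by blast
      have "N (d, n) \<in> \<G>"
        unfolding \<G>_def using d(1) by blast
      then have "v \<in> N (d, n)"
        using v by blast
      then obtain i where "dist (v i) d < inverse (real (Suc n))"
        by (auto simp: N_def)
      then have "dist (v i) x < e"
        using dist_triangle[of "v i" x d] d(2) n by linarith
      then show ?thesis
        by blast
    qed
    then show ?thesis
      by (auto simp: closure_approachable)
  qed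
  \<comment> \<open>By \<open>gs_eq_0_mono\<close> this is an initial segment of the natural
    numbers, possibly all of them.\<close>
  define I where "I = {i. gs v i \<noteq> 0}"
  define e where "e i = gs v i /\<^sub>R norm (gs v i)" for i
  have orth: "orthonormal_on I e"
    unfolding orthonormal_on_def
  proof (intro ballI)
    fix i j
    assume "i \<in> I" "j \<in> I"
    then have "norm (e i) = 1"
      by (simp add: e_def I_def)
    then have "ip (e i) (e i) = 1"
      by (simp add: ip_self)
    moreover have "ip (e i) (e j) = 0" if "i \<noteq> j"
      using ip_gs[OF that] by (simp add: e_def ip_scaleR ip_scaleR_right)
    ultimately show "ip (e i) (e j) = (if i = j then 1 else 0)"
      by auto
  qed
  have gs_e: "gs v i = norm (gs v i) *\<^sub>R e i" for i
    by (cases "gs v i = 0") (simp_all add: e_def)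
  have upto: "{..m} \<subseteq> I" if "m \<in> I" for m
    using that gs_eq_0_mono unfolding I_def by blast
  have nonzero: "ip (A k (e i)) (e j) \<noteq> 0" if "i \<in> I" "j \<in> I" for i j k
  proof -
    have "max i j \<in> I"
      using that by (simp add: max_def)
    \<comment> \<open>The system \<open>e\<close> itself shows that there is room for a witness
      \<open>h\<close>; \<open>gs\<close> fixes \<open>h\<close> on these indices, and genericity
      carries the nonzero entry over to \<open>v\<close>.\<close>
    then have "orthonormal_on {..max i j} e"
      using orthonormal_on_subset[OF orth upto] by blast
    then obtain h where "orthonormal_on {..max i j} h" "ip (A k (h i)) (h j) \<noteq> 0"
      using orthonormal_on_witness[OF A, of "max i j" e i j k] by auto
    then have "ip (A k (gs h i)) (gs h j) \<noteq> 0"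
      by (simp add: gs_orthonormal)
    then have "ip (A k (gs v i)) (gs v j) \<noteq> 0"
      by (intro generic) auto
    moreover have "linear (A k)"
      using blin by (simp add: bounded_linear.linear)
    ultimately show ?thesis
      using that by (simp add: e_def I_def linear_scale ip_scaleR ip_scaleR_right)
  qed
  have "closure (quat_span act (e ` I)) = UNIV"
  proof (cases "I = UNIV")
    case True
    have gs_span: "gs v i \<in> quat_span act (e ` I)" for i
      using True by (subst gs_e) (intro quat_span_scaleR quat_span_base, auto)
    \<comment> \<open>No Gram-Schmidt vector vanishes, so the recursion can be solved for
      \<open>v n\<close>; the span then contains the dense range of \<open>v\<close>.\<close>
    have "v n \<in> quat_span act (e ` I)" for n
    proof -
      let ?D = "\<Prod>j<n. (norm (gs v j))\<^sup>2"
      define s where "s = (\<Sum>i<n. (\<Prod>j\<in>{..<n} - {i}. (norm (gs v j))\<^sup>2) *\<^sub>R act (ip (v n) (gs v i)) (gs v i))"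
      have "gs v n = ?D *\<^sub>R v n - s"
        unfolding s_def by (rule gs.simps)
      then have "?D *\<^sub>R v n = gs v n + s"
        by simp
      also have "\<dots> \<in> quat_span act (e ` I)"
        unfolding s_def by (intro quat_span_add quat_span_sum quat_span_scaleR quat_span_act gs_span)
      finally have "inverse ?D *\<^sub>R ?D *\<^sub>R v n \<in> quat_span act (e ` I)"
        by (rule quat_span_scaleR)
      moreover have "?D \<noteq> 0"
        using True by (auto simp: I_def)
      ultimately show ?thesis
        by simp
    qed
    then have "closure (range v) \<subseteq> closure (quat_span act (e ` I))"
      by (intro closure_mono) auto
    then show ?thesis
      unfolding dense by (rule top.extremum_uniqueI)
  next
    case False
    define m where "m = (LEAST i. i \<notin> I)"
    have "m \<notin> I"
      unfolding m_def using False by (metis LeastI UNIV_eq_I)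
    have below: "i \<in> I" if "i < m" for i
      using not_less_Least[of i "\<lambda>i. i \<notin> I"] that unfolding m_def by blast
    have em: "orthonormal_on {..<m} e"
      using orthonormal_on_subset[OF orth] below by blast
    have "x \<in> quat_span act (e ` I)" for x
    proof (rule ccontr)
      assume x: "x \<notin> quat_span act (e ` I)"
      have "proj {..<m} e x \<in> quat_span act (e ` I)"
        unfolding proj_def using below by (intro quat_span_sum quat_span_act quat_span_base) auto
      then have "x \<noteq> proj {..<m} e x"
        using x by auto
      \<comment> \<open>With the residual \<open>y\<close> in slot \<open>m\<close> the Gram-Schmidt
        vector there is a nonzero multiple of \<open>y\<close>. Genericity for \<open>id\<close>
        then makes \<open>gs v m\<close> nonzero, against the choice of \<open>m\<close>.\<close>
      define y where "y = x - proj {..<m} e x"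
      have "y \<noteq> 0"
        using \<open>x \<noteq> _\<close> by (simp add: y_def)
      have y: "ip y (gs v i) = 0" if "i < m" for i
        using ip_diff_proj[OF _ em, of i x] that by (subst gs_e) (simp add: ip_scaleR_right y_def)
      have same: "gs (v(m := y)) i = gs v i" if "i < m" for i
        using that by (intro gs_cong) auto
      have "gs (v(m := y)) m = (\<Prod>j<m. (norm (gs v j))\<^sup>2) *\<^sub>R y"
        unfolding gs.simps[of "v(m := y)" m] by (simp add: same y cong: prod.cong_simp sum.cong_simp)
      moreover have "(\<Prod>j<m. (norm (gs v j))\<^sup>2) \<noteq> 0"
        using below by (auto simp: I_def)
      ultimately have "gs (v(m := y)) m \<noteq> 0"
        using \<open>y \<noteq> 0\<close> by simp
      then have "ip (id (gs (v(m := y)) m)) (gs (v(m := y)) m) \<noteq> 0"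
        by simp
      then have "ip (id (gs v m)) (gs v m) \<noteq> 0"
        by (intro generic) auto
      then show False
        using \<open>m \<notin> I\<close> by (simp add: I_def)
    qed
    then have "quat_span act (e ` I) = UNIV"
      by blast
    then show ?thesis
      by simp
  qed
  moreover have "ip x y = (if x = y then 1 else 0)" if "x \<in> e ` I" "y \<in> e ` I" for x y
    using that orth by (auto simp: orthonormal_on_def)
  ultimately have "orthonormal_basis act ip (e ` I)"
    by (simp add: orthonormal_basis_def)
  then show ?thesis
    using nonzero by blast
qed

end

text \<open>The residual is orthogonal to the basis, hence by continuity to the closure of its span,
  which contains the residual itself.\<close>

lemma (in right_quat_hilbert) orthonormal_basis_expansion:
  assumes "orthonormal_basis act ip E" "finite E"
  shows "orthonormal_on E id" and "proj E id x = x"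
proof -
  show orth: "orthonormal_on E id"
    using assms(1) by (simp add: orthonormal_basis_def orthonormal_on_def)
  define y where "y = x - proj E id x"
  have perp: "ip e y = 0" if "e \<in> E" for e
    using ip_diff_proj[OF assms(2) orth that] ip_eq_0_commute by (simp add: y_def)
  have "quat_span act E \<subseteq> {z. ip z y = 0}"
    using perp by (auto simp: quat_span_def ip_linear_simps subset_eq)
  moreover have "closed {z. ip z y = 0}"
    by (intro closed_Collect_eq continuous_intros)
  ultimately have "closure (quat_span act E) \<subseteq> {z. ip z y = 0}"
    by (rule closure_minimal)
  moreover have "y \<in> closure (quat_span act E)"
    using assms(1) by (simp add: orthonormal_basis_def)
  ultimately have "ip y y = 0"
    by blast
  then show "proj E id x = x"
    by (simp add: y_def)
qed

section \<open>Left spaces\<close>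

text \<open>Conjugation reverses products, which turns \<open>act_act\<close> around and moves the
  factor in \<open>ip_act\<close> to the other side.\<close>

lemma (in left_quat_hilbert) right_quat_hilbert_conj:
  "right_quat_hilbert (\<lambda>q. act (qconj q)) (\<lambda>x y. qconj (ip x y))"
proof
  fix p q :: quat and x y z :: 'a and r :: real
  show "qconj (ip y x) = qconj (qconj (ip x y))"
    using ip_conj[of y x] by simp
  show "qconj (ip x x) = of_real ((norm x)\<^sup>2)"
    unfolding ip_self qconj_simps ..
qed (simp_all add: act_add_vec act_add_quat act_of_real ip_add act_act ip_act qconj_mult)

lemma bounded_quat_linear_conj:
  "bounded_quat_linear (\<lambda>q. act (qconj q)) T \<longleftrightarrow> bounded_quat_linear act T"
  unfolding bounded_quat_linear_def by (metis qconj_simps(1))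

lemma quat_span_conj: "quat_span (\<lambda>q. act (qconj q)) S = quat_span act (S :: 'a::real_vector set)"
proof -
  \<comment> \<open>Stated for every action, so that the conjugated action gives the reverse
    inclusion.\<close>
  have "quat_span act S \<subseteq> quat_span (\<lambda>q. act (qconj q)) S" for act :: "quat \<Rightarrow> 'a \<Rightarrow> 'a"
  proof
    fix x
    assume "x \<in> quat_span act S"
    then obtain F c where "finite F" "F \<subseteq> S" "x = (\<Sum>y\<in>F. act (c y) y)"
      by (auto simp: quat_span_def)
    then show "x \<in> quat_span (\<lambda>q. act (qconj q)) S"
      unfolding quat_span_def by (intro CollectI exI[of _ F] exI[of _ "\<lambda>y. qconj (c y)"]) simp
  qed
  from this[of act] this[of "\<lambda>q. act (qconj q)"] show ?thesis
    by simp
qed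

lemma orthonormal_basis_conj:
  "orthonormal_basis (\<lambda>q. act (qconj q)) (\<lambda>x y. qconj (ip x y)) E \<longleftrightarrow> orthonormal_basis act ip E"
proof -
  have "qconj p = (if b then 1 else 0) \<longleftrightarrow> p = (if b then 1 else 0)" for p b
    by (auto simp: quat_eq_iff)
  then show ?thesis
    by (simp add: orthonormal_basis_def quat_span_conj)
qed

section \<open>Column vectors and matrices\<close>

text \<open>Scalars act from the right so that they commute with a matrix acting from the
  left.\<close>

definition vec_act :: "quat \<Rightarrow> quat^'n \<Rightarrow> quat^'n"
  where "vec_act q x = (\<chi> i. x $ i * q)"

definition vec_ip :: "quat^'n \<Rightarrow> quat^'n \<Rightarrow> quat"
  where "vec_ip x y = (\<Sum>i\<in>UNIV. qconj (y $ i) * x $ i)"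

interpretation vec: right_quat_hilbert vec_act vec_ip
proof
  fix p q :: quat and x y z :: "quat^'n" and r :: real
  show "vec_act (of_real r) x = r *\<^sub>R x"
    by (simp add: vec_act_def vec_eq_iff)
      (simp add: scaleR_conv_of_real of_real_mult_commute_quat[of r, symmetric])
  show "vec_ip x x = of_real ((norm x)\<^sup>2)"
    by (simp add: vec_ip_def qconj_mult_self qnorm2_eq_norm norm_vec_def L2_set_def sum_nonneg)
qed (simp_all add: vec_act_def vec_ip_def vec_eq_iff algebra_simps sum.distrib qconj_sum qconj_mult
    sum_distrib_right)

lemma separable_space_euclidean: "separable_space (euclidean :: 'a::second_countable_topology topology)"
proof -
  obtain D :: "'a set" where "countable D" and D: "\<And>X. open X \<Longrightarrow> X \<noteq> {} \<Longrightarrow> \<exists>d\<in>D. d \<in> X"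
    by (rule countable_dense_setE) blast
  have "closure D = UNIV"
    using D[of "- closure D"] closure_subset[of D] by blast
  then show ?thesis
    using \<open>countable D\<close> unfolding separable_space_def by auto
qed

lemma linear_matrix_vector_mult_quat: "linear ((*v) (M :: quat^'n^'m))"
  by (rule linearI)
    (simp_all add: vec_eq_iff matrix_vector_mult_def distrib_left sum.distrib scaleR_sum_right)

lemma bounded_quat_linear_matrix: "bounded_quat_linear vec_act ((*v) (M :: quat^'n^'n))"
proof -
  have "M *v vec_act q x = vec_act q (M *v x)" for q x
    by (simp add: vec_eq_iff matrix_vector_mult_def vec_act_def sum_distrib_right mult.assoc)
  then show ?thesis
    using linear_matrix_vector_mult_quat[of M]
    by (simp add: bounded_quat_linear_def linear_conv_bounded_linear)
qed

lemma realscalar_op_matrix: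
  fixes M :: "quat^'n^'n"
  assumes "realscalar_op ((*v) M)"
  shows "realscalar_matrix M"
proof -
  obtain r where r: "M *v x = r *\<^sub>R x" for x
    using assms by (auto simp: realscalar_op_def fun_eq_iff)
  have "M $ i $ j = (if i = j then of_real r else 0)" for i j
  proof -
    have "M $ i $ j = (M *v axis j 1) $ i"
      by (simp add: matrix_vector_mult_def axis_def if_distrib cong: if_cong)
    also have "\<dots> = (if i = j then of_real r else 0)"
      by (simp add: r axis_def of_real_def)
    finally show ?thesis .
  qed
  then have "M = mat (of_real r)"
    by (simp add: vec_eq_iff mat_def)
  then show ?thesis
    by (auto simp: realscalar_matrix_def)
qed

section \<open>Unitary matrices from orthonormal bases\<close>

lemma vec_ip_axis: "vec_ip (axis j 1) y = qconj (y $ j)"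
  by (simp add: vec_ip_def axis_def if_distrib cong: if_cong)

lemma orthonormal_on_axis: "vec.orthonormal_on UNIV (\<lambda>i. axis i 1 :: quat^'n)"
  by (simp add: vec.orthonormal_on_def vec_ip_axis) (simp add: axis_def)

lemma proj_axis: "vec.proj UNIV (\<lambda>i. axis i 1) x = (x :: quat^'n)"
proof -
  have "vec_ip x (axis i 1) = x $ i" for i
    by (simp add: vec_ip_def axis_def if_distrib if_distribR cong: if_cong)
  then show ?thesis
    by (simp add: vec.proj_def vec_eq_iff vec_act_def axis_def if_distrib if_distribR cong: if_cong)
qed

text \<open>The coordinate basis is compared with \<open>E\<close> in both directions. The first
  comparison bounds all finite subsets, hence makes \<open>E\<close> finite; only then is the
  expansion in \<open>E\<close> available for the second.\<close>

lemma orthonormal_basis_vec_bij: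
  fixes E :: "(quat^'n) set"
  assumes E: "orthonormal_basis vec_act vec_ip E"
  obtains f where "bij_betw f (UNIV :: 'n set) E"
proof -
  have le: "card F \<le> CARD('n)" if "F \<subseteq> E" "finite F" for F
  proof -
    have "vec.orthonormal_on F id"
      using E that(1) by (simp add: vec.orthonormal_on_def orthonormal_basis_def subset_eq)
    then show ?thesis
      using vec.orthonormal_on_card_le[OF _ orthonormal_on_axis that(2)] by (simp add: proj_axis)
  qed
  then have "finite E"
    using finite_if_finite_subsets_card_bdd[of E "CARD('n)"] by blast
  moreover have "CARD('n) \<le> card E"
    using vec.orthonormal_basis_expansion[OF E \<open>finite E\<close>]
    by (intro vec.orthonormal_on_card_le[OF _ _ _ orthonormal_on_axis]) (auto simp: \<open>finite E\<close>)
  ultimately have "card E = CARD('n)"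
    using le[of E] by simp
  then show ?thesis
    using finite_same_card_bij[of "UNIV :: 'n set" E] \<open>finite E\<close> that by auto
qed

text \<open>One unitarity equation is orthonormality of the columns, the other is the expansion of
  the coordinate vectors in \<open>E\<close>.\<close>

lemma unitary_matrix_of_basis:
  fixes E :: "(quat^'n) set"
  assumes E: "orthonormal_basis vec_act vec_ip E" and f: "bij_betw f UNIV E"
  shows "unitary_matrix (\<chi> i j. f j $ i)"
proof -
  let ?P = "\<chi> i j. f j $ i"
  have range: "f i \<in> E" and inj: "f i = f j \<longleftrightarrow> i = j" for i j
    using f by (auto simp: bij_betw_def inj_eq)
  have "finite E"
    using bij_betw_finite[OF f] by simp
  have "vec_ip (f j) (f i) = (if i = j then 1 else 0)" for i j
    using E range by (auto simp: orthonormal_basis_def inj)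
  then have "conj_transpose ?P ** ?P = mat 1"
    by (simp add: vec_eq_iff conj_transpose_def matrix_matrix_mult_def mat_def vec_ip_def)
  moreover have "?P ** conj_transpose ?P = mat 1"
  proof -
    have "(\<Sum>l\<in>UNIV. f l $ i * qconj (f l $ j)) = (if i = j then 1 else 0)" for i j
    proof -
      have "(\<Sum>l\<in>UNIV. f l $ i * qconj (f l $ j)) = (\<Sum>e\<in>E. e $ i * qconj (e $ j))"
        by (rule sum.reindex_bij_betw[OF f])
      also have "\<dots> = vec.proj E id (axis j 1) $ i"
        by (simp add: vec.proj_def vec_act_def vec_ip_axis)
      also have "\<dots> = axis j 1 $ i"
        using vec.orthonormal_basis_expansion(2)[OF E \<open>finite E\<close>] by simp
      finally show ?thesis
        by (simp add: axis_def)
    qed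
    then show ?thesis
      by (simp add: vec_eq_iff conj_transpose_def matrix_matrix_mult_def mat_def)
  qed
  ultimately show ?thesis
    by (simp add: unitary_matrix_def)
qed

theorem theorem3p2:
  shows
    "(\<forall>(act :: quat \<Rightarrow> 'a::banach \<Rightarrow> 'a) ip (A :: nat \<Rightarrow> 'a \<Rightarrow> 'a).
        right_quat_hilbert act ip \<longrightarrow>
        separable_space (euclidean :: 'a topology) \<longrightarrow>
        (\<forall>k. bounded_quat_linear act (A k) \<and> \<not> realscalar_op (A k)) \<longrightarrow>
        (\<exists>E. orthonormal_basis act ip E \<and>
             (\<forall>e\<in>E. \<forall>e'\<in>E. \<forall>k. ip (A k e) e' \<noteq> 0)))
     \<and> (\<forall>(act :: quat \<Rightarrow> 'b::banach \<Rightarrow> 'b) ip (A :: nat \<Rightarrow> 'b \<Rightarrow> 'b).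
        left_quat_hilbert act ip \<longrightarrow>
        separable_space (euclidean :: 'b topology) \<longrightarrow>
        (\<forall>k. bounded_quat_linear act (A k) \<and> \<not> realscalar_op (A k)) \<longrightarrow>
        (\<exists>E. orthonormal_basis act ip E \<and>
             (\<forall>e\<in>E. \<forall>e'\<in>E. \<forall>k. ip (A k e) e' \<noteq> 0)))
     \<and> (\<forall>A :: nat \<Rightarrow> quat^'n^'n.
        (\<forall>k. \<not> realscalar_matrix (A k)) \<longrightarrow>
        (\<exists>P :: quat^'n^'n. unitary_matrix P \<and>
             (\<forall>k i j. (conj_transpose P ** A k ** P) $ i $ j \<noteq> 0)))"
proof (intro conjI allI impI)
  fix act :: "quat \<Rightarrow> 'a \<Rightarrow> 'a" and ip and A :: "nat \<Rightarrow> 'a \<Rightarrow> 'a"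
  assume "right_quat_hilbert act ip" "separable_space (euclidean :: 'a topology)"
    "\<forall>k. bounded_quat_linear act (A k) \<and> \<not> realscalar_op (A k)"
  then show "\<exists>E. orthonormal_basis act ip E \<and> (\<forall>e\<in>E. \<forall>e'\<in>E. \<forall>k. ip (A k e) e' \<noteq> 0)"
    using right_quat_hilbert.exists_orthonormal_basis_nonzero_entries by blast
next
  fix act :: "quat \<Rightarrow> 'b \<Rightarrow> 'b" and ip and A :: "nat \<Rightarrow> 'b \<Rightarrow> 'b"
  assume left: "left_quat_hilbert act ip" and sep: "separable_space (euclidean :: 'b topology)"
    and A: "\<forall>k. bounded_quat_linear act (A k) \<and> \<not> realscalar_op (A k)"
  interpret right_quat_hilbert "\<lambda>q. act (qconj q)" "\<lambda>x y. qconj (ip x y)"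
    by (rule left_quat_hilbert.right_quat_hilbert_conj[OF left])
  have "bounded_quat_linear (\<lambda>q. act (qconj q)) (A k)" "\<not> realscalar_op (A k)" for k
    using A by (simp_all add: bounded_quat_linear_conj)
  from exists_orthonormal_basis_nonzero_entries[OF sep this]
  show "\<exists>E. orthonormal_basis act ip E \<and> (\<forall>e\<in>E. \<forall>e'\<in>E. \<forall>k. ip (A k e) e' \<noteq> 0)"
    by (simp add: orthonormal_basis_conj)
next
  fix A :: "nat \<Rightarrow> quat^'n^'n"
  assume A: "\<forall>k. \<not> realscalar_matrix (A k)"
  have "\<not> realscalar_op ((*v) (A k))" for k
    using A realscalar_op_matrix by blast
  from vec.exists_orthonormal_basis_nonzero_entries[where A = "\<lambda>k. (*v) (A k)",
      OF separable_space_euclidean bounded_quat_linear_matrix this]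
  obtain E where E: "orthonormal_basis vec_act vec_ip E"
    and nonzero: "\<And>e e' k. e \<in> E \<Longrightarrow> e' \<in> E \<Longrightarrow> vec_ip (A k *v e) e' \<noteq> 0"
    by blast
  obtain f where f: "bij_betw f (UNIV :: 'n set) E"
    using orthonormal_basis_vec_bij[OF E] .
  define P where "P = (\<chi> i j. f j $ i)"
  have "(conj_transpose P ** A k ** P) $ i $ j = vec_ip (A k *v f j) (f i)" for k i j
  proof -
    \<comment> \<open>Bracketed to the right, the double sum becomes the inner product of
      \<open>A k\<close> applied to column \<open>j\<close> with column \<open>i\<close>.\<close>
    have "(conj_transpose P ** A k ** P) $ i $ j = (conj_transpose P ** (A k ** P)) $ i $ j"
      by (simp only: matrix_mul_assoc)
    also have "\<dots> = vec_ip (A k *v f j) (f i)"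
      by (simp add: matrix_matrix_mult_def matrix_vector_mult_def conj_transpose_def P_def vec_ip_def)
    finally show ?thesis .
  qed
  moreover have "f i \<in> E" for i
    using f by (auto simp: bij_betw_def)
  ultimately have "(conj_transpose P ** A k ** P) $ i $ j \<noteq> 0" for k i j
    using nonzero by simp
  moreover have "unitary_matrix P"
    unfolding P_def by (rule unitary_matrix_of_basis[OF E f])
  ultimately show "\<exists>P :: quat^'n^'n. unitary_matrix P \<and>
      (\<forall>k i j. (conj_transpose P ** A k ** P) $ i $ j \<noteq> 0)"
    by blast
qed

end
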